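(* Let $V$ be a generalized vertex algebra with a charge factor $(Q,\Delta,\eta)$, and let $B$ be a totally ordered set with a map $i:B\to V$ such that every element of $i(B)$ is a non-zero $Q$-homogeneous vector and $i(B)$ generates $V$. Let $\mathcal{N}:B\times B\to\mathbb{C}$ be a symmetric map such that for all $a,b\in B$ the number $\mathcal{N}(a,b)$ is a locality bound of the fields $Y(i(a),z)$ and $Y(i(b),z)$. Let $k$ be a non-negative integer, $M$ an integer and $a_1\le\cdots\le a_k$ elements of $B$. Then: (1) the set $\mathcal{C}(a_1,\ldots,a_k;M)$ spans the vector space $V(a_1,\ldots,a_k;M)$; (2) if $M>-k$, then $V(a_1,\ldots,a_k;M)=0$.
   Context: All vector spaces are over a field $\mathbf{k}\supseteq\mathbb{C}$. GVAs. $U[[z,z^{\mathbb{C}}]]$ is the space of formal series $\sum_{n\in\mathbb{C}}f(n)z^n$ with $f(n)\in U$; for a coset $\Gamma\in\mathbb{C}/\mathbb{Z}$, $U[[z]]z^\Gamma$ is the space of finite sums of $\psi(z)z^d$ with $d\in\Gamma$, $\psi\in U[[z]]$. Put $\iota_{z,w}(z-w)^N=\sum_{j\ge0}\binom Nj z^{N-j}(-w)^j$ and $\iota_{w,z}(z-w)^N=e^{\pi iN}\sum_{j\ge0}\binom Nj w^{N-j}(-z)^j$. A weak GVA $(V,Y,|0\rangle,T)$ is a vector space $V$ with a non-zero vector $|0\rangle$, $T\in\mathrm{End}(V)$ and a linear map $Y:V\to\mathrm{End}(V)[[z,z^{\mathbb{C}}]]$, $Y(a,z)=\sum_{n\in\mathbb{C}}a(n)z^{-n-1}$,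 such that $T|0\rangle=0$, $Y(a,z)|0\rangle|_{z=0}=a$ (in particular $Y(a,z)|0\rangle\in V[[z]]$) and $[T,Y(a,z)]=\partial_zY(a,z)$. Given an abelian group $Q$, a symmetric biadditive $\Delta:Q\times Q\to\mathbb{C}/\mathbb{Z}$ and a grading $V=\bigoplus_{\alpha\in Q}V^\alpha$, a field of charge $\alpha$ is a series $a(z)\in\mathrm{End}(V)[[z,z^{\mathbb{C}}]]$ with $a(z)b\in V^{\alpha+\beta}[[z]]z^{-\Delta(\alpha,\beta)}$ for $b\in V^\beta$. Fields $a(z),b(z)$ of charges $\alpha,\beta$ are mutually $p$-local ($p\in\mathbb{C}^\times$) if there is $N\in\Delta(\alpha,\beta)$, called a locality bound, with $\iota_{z,w}(z-w)^Na(z)b(w)=p\,\iota_{w,z}(z-w)^Nb(w)a(z)$. A generalized vertex algebra (GVA) is a weak GVA admitting a charge factor $(Q,\Delta,\eta)$: an abelian group $Q$, a symmetric biadditive $\Delta$, a grading $V=\bigoplus_{\alpha\in Q}V^\alpha$ and a bimultiplicative $\eta:Q\times Q\to\mathbb{C}^\times$ with $\eta(\alpha,\beta)\eta(\beta,\alpha)=e^{-2\pi i\Delta(\alpha,\beta)}$, such that $|0\rangle\in V^0$, $T$ preserves the grading, $Y(a,z)$ is a field of charge $\alpha$ for $a\in V^\alpha$, and $Y(a,z),Y(b,z)$ are mutually $\eta(\alpha,\beta)$-local for $a\in V^\alpha,b\in V^\beta$. For $Y(i(a),z)$ and $Y(i(b),z)$, a locality bound is meant with $p=\eta(\alpha,\beta)$,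 where $\alpha,\beta$ are the charges of $i(a),i(b)$. A subset generates $V$ if the smallest $T$-invariant subspace containing it and $|0\rangle$ and closed under all products $u(n)v$ ($n\in\mathbb{C}$) is $V$. Notation. Write $a$ for $i(a)$ ($a\in B$). For $a_1,\ldots,a_k\in B$ and $m_1,\ldots,m_k\in\mathbb{C}$ put $$\Psi(a_1,m_1;\cdots;a_k,m_k)=a_k\bigl(m_k+\textstyle\sum_{j=1}^{k-1}\mathcal{N}(a_k,a_j)\bigr)\cdots a_2\bigl(m_2+\mathcal{N}(a_2,a_1)\bigr)\,a_1(m_1)\,|0\rangle,$$ and $\Psi(\ )=|0\rangle$ for $k=0$. For $a_1\le\cdots\le a_k$ in $B$ and $M\in\mathbb{Z}$, $V(a_1,\ldots,a_k;M)\subset V$ is the span of all $\Psi(a_1,m_1;\cdots;a_k,m_k)$ with $m_1,\ldots,m_k\in\mathbb{Z}$, $m_1+\cdots+m_k=M$ (so for $k=0$ it is the span of $|0\rangle$ if $M=0$ and $0$ otherwise), and $\mathcal{C}(a_1,\ldots,a_k;M)$ is the set of all $\Psi(a_1,m_1;\cdots;a_k,m_k)$ with negative integers $m_1,\ldots,m_k$ such that $m_1+\cdots+m_k=M$ and $m_i\ge m_j$ whenever $i<j$ and $a_i=a_j$ (empty if $M>-k$). *)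

theory Defs
  imports Complex_Main "HOL-Library.Groups_Big_Fun"
begin

section \<open>The group \<open>\<complex>/\<int>\<close>\<close>

quotient_type complex_mod_int = complex / "\<lambda>x y. x - y \<in> \<int>"
proof (rule equivpI)
  show "reflp (\<lambda>x y :: complex. x - y \<in> \<int>)"
    by (simp add: reflp_def)
  show "symp (\<lambda>x y :: complex. x - y \<in> \<int>)"
  proof (rule sympI)
    fix x y :: complex
    assume "x - y \<in> \<int>"
    then have "- (x - y) \<in> \<int>" by (rule Ints_minus)
    then show "y - x \<in> \<int>" by simp
  qed
  show "transp (\<lambda>x y :: complex. x - y \<in> \<int>)"
  proof (rule transpI)
    fix x y z :: complex
    assume "x - y \<in> \<int>" "y - z \<in> \<int>"
    then have "(x - y) + (y - z) \<in> \<int>" by (rule Ints_add)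
    then show "x - z \<in> \<int>" by simp
  qed
qed

instantiation complex_mod_int :: ab_group_add
begin

lift_definition zero_complex_mod_int :: complex_mod_int is 0 .

lift_definition plus_complex_mod_int ::
  "complex_mod_int \<Rightarrow> complex_mod_int \<Rightarrow> complex_mod_int" is "(+)"
proof -
  fix x y u v :: complex
  assume "x - y \<in> \<int>" "u - v \<in> \<int>"
  then have "(x - y) + (u - v) \<in> \<int>" by (rule Ints_add)
  then show "(x + u) - (y + v) \<in> \<int>" by (simp add: algebra_simps)
qed

lift_definition uminus_complex_mod_int :: "complex_mod_int \<Rightarrow> complex_mod_int" is uminus
proof -
  fix x y :: complex
  assume "x - y \<in> \<int>"
  then have "- (x - y) \<in> \<int>" by (rule Ints_minus)
  then show "- x - - y \<in> \<int>" by simp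
qed

lift_definition minus_complex_mod_int ::
  "complex_mod_int \<Rightarrow> complex_mod_int \<Rightarrow> complex_mod_int" is "(-)"
proof -
  fix x y u v :: complex
  assume "x - y \<in> \<int>" "u - v \<in> \<int>"
  then have "(x - y) - (u - v) \<in> \<int>" by (rule Ints_diff)
  then show "(x - u) - (y - v) \<in> \<int>" by (simp add: algebra_simps)
qed

instance
  by standard (transfer; simp)+

end

lift_definition int_coset :: "complex \<Rightarrow> complex_mod_int" is "\<lambda>z. z" .

lift_definition exp_2pi_i :: "complex_mod_int \<Rightarrow> complex" is "\<lambda>z. exp (2 * of_real pi * \<i> * z)"
proof -
  fix x y :: complex
  assume "x - y \<in> \<int>"
  then obtain n :: int where "x - y = of_int n"
    by (rule Ints_cases)
  then have "x = y + of_int n"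
    by (simp add: diff_eq_eq add.commute)
  moreover have "exp (2 * of_real pi * \<i> * of_int n) = cis (2 * pi * of_int n)"
    by (simp add: cis_conv_exp mult_ac)
  moreover have "cis (2 * pi * of_int n) = 1"
    by (rule cis_multiple_2pi) simp
  ultimately show "exp (2 * of_real pi * \<i> * x) = exp (2 * of_real pi * \<i> * y)"
    by (simp add: distrib_left exp_add)
qed


section \<open>Formal series with complex exponents\<close>

text \<open>
  An element of \<open>U[[z, z\<^sup>\<complex>]]\<close> is the function sending an exponent \<open>x :: complex\<close> to the
  coefficient of \<open>z\<close> to the power \<open>x\<close>.  A series \<open>a(z) = \<Sum> a(n) z\<^sup>-\<^sup>n\<^sup>-\<^sup>1\<close> of endomorphisms is given by
  its modes, \<open>a n v = a(n)v\<close>; \<open>zcoeff a x v\<close> is the coefficient of \<open>z\<close> to the power \<open>x\<close> in \<open>a(z)v\<close>.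
\<close>

definition zcoeff :: "(complex \<Rightarrow> 'v \<Rightarrow> 'v) \<Rightarrow> complex \<Rightarrow> 'v \<Rightarrow> 'v" where
  "zcoeff a x = a (- x - 1)"

text \<open>The series \<open>\<psi>(z) z\<^sup>d\<close> for \<open>\<psi>(z) = \<Sum>j. \<psi> j z\<^sup>j\<close>.\<close>

definition shifted_series :: "(nat \<Rightarrow> 'v) \<Rightarrow> complex \<Rightarrow> complex \<Rightarrow> 'v :: ab_group_add" where
  "shifted_series \<psi> d x = (if x - d \<in> \<nat> then \<psi> (THE j. x - d = of_nat j) else 0)"

text \<open>
  The space \<open>U[[z]] z\<^sup>\<Gamma>\<close> for a subspace \<open>U\<close>; terms with the same \<open>d\<close> have been combined.
\<close>

definition coset_series :: "'v set \<Rightarrow> complex_mod_int \<Rightarrow> (complex \<Rightarrow> 'v :: ab_group_add) set" where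
  "coset_series U \<Gamma> = {f. \<exists>D \<psi>. finite D \<and> (\<forall>d\<in>D. int_coset d = \<Gamma> \<and> (\<forall>j. \<psi> d j \<in> U)) \<and>
     f = (\<lambda>x. \<Sum>d\<in>D. shifted_series (\<psi> d) d x)}"

text \<open>
  Multiplication of a series \<open>\<Sum> F x y z\<^sup>x w\<^sup>y\<close> by the expansions of \<open>(z - w)\<^sup>N\<close> in the two domains.
  \<open>emb\<close> is the inclusion of the complex numbers into the ground field.  The series to which this is
  applied, \<open>a(z)b(w)c\<close> and \<open>b(w)a(z)c\<close> for fields \<open>a\<close>, \<open>b\<close>, have lower bounded exponents of \<open>w\<close>,
  resp. \<open>z\<close>, so that the sums over \<open>j\<close> have only finitely many non-zero terms.
\<close>

definition iota_zw_mult ::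
  "(complex \<Rightarrow> 'k) \<Rightarrow> ('k \<Rightarrow> 'v \<Rightarrow> 'v) \<Rightarrow> complex \<Rightarrow>
     (complex \<Rightarrow> complex \<Rightarrow> 'v) \<Rightarrow> complex \<Rightarrow> complex \<Rightarrow> 'v :: ab_group_add" where
  "iota_zw_mult emb scale N F x y =
     Sum_any (\<lambda>j::nat. scale (emb ((N gchoose j) * (-1) ^ j)) (F (x - (N - of_nat j)) (y - of_nat j)))"

definition iota_wz_mult ::
  "(complex \<Rightarrow> 'k) \<Rightarrow> ('k \<Rightarrow> 'v \<Rightarrow> 'v) \<Rightarrow> complex \<Rightarrow>
     (complex \<Rightarrow> complex \<Rightarrow> 'v) \<Rightarrow> complex \<Rightarrow> complex \<Rightarrow> 'v :: ab_group_add" where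
  "iota_wz_mult emb scale N F x y = scale (emb (exp (of_real pi * \<i> * N)))
     (Sum_any (\<lambda>j::nat. scale (emb ((N gchoose j) * (-1) ^ j)) (F (x - of_nat j) (y - (N - of_nat j)))))"


section \<open>Generalized vertex algebras\<close>

text \<open>
  \<open>scale\<close> is the scalar multiplication of a vector space on the type \<open>'v\<close> over the field \<open>'k\<close>.
\<close>

locale weak_gva = vector_space scale
  for scale :: "'k :: field \<Rightarrow> 'v :: ab_group_add \<Rightarrow> 'v" +
  fixes emb :: "complex \<Rightarrow> 'k"
    and Y :: "'v \<Rightarrow> complex \<Rightarrow> 'v \<Rightarrow> 'v"
    and vac :: 'v
    and T :: "'v \<Rightarrow> 'v"
  assumes emb_one: "emb 1 = 1"
    and emb_add: "emb (x + y) = emb x + emb y"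
    and emb_mult: "emb (x * y) = emb x * emb y"
    and Y_endo: "Vector_Spaces.linear scale scale (Y a n)"
    and Y_linear: "Vector_Spaces.linear scale scale (\<lambda>a. Y a n v)"
    and T_linear: "Vector_Spaces.linear scale scale T"
    and vac_nonzero: "vac \<noteq> 0"
    and T_vac: "T vac = 0"
    and creation: "\<exists>\<psi>. (\<lambda>x. zcoeff (Y a) x vac) = shifted_series \<psi> 0 \<and> \<psi> 0 = a"
    and T_commutator:
      "T (zcoeff (Y a) x v) - zcoeff (Y a) x (T v) = scale (emb (x + 1)) (zcoeff (Y a) (x + 1) v)"

definition direct_sum_decomposition ::
  "('k :: field \<Rightarrow> 'v \<Rightarrow> 'v) \<Rightarrow> ('q \<Rightarrow> 'v :: ab_group_add set) \<Rightarrow> bool" where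
  "direct_sum_decomposition scale Vgr \<longleftrightarrow>
     (\<forall>\<alpha>. module.subspace scale (Vgr \<alpha>)) \<and>
     (\<forall>v. \<exists>!f. finite {\<alpha>. f \<alpha> \<noteq> 0} \<and> (\<forall>\<alpha>. f \<alpha> \<in> Vgr \<alpha>) \<and> v = Sum_any f)"

definition is_field_of_charge ::
  "('k :: field \<Rightarrow> 'v \<Rightarrow> 'v) \<Rightarrow> ('q \<Rightarrow> 'v :: ab_group_add set) \<Rightarrow> ('q \<Rightarrow> 'q \<Rightarrow> complex_mod_int) \<Rightarrow>
     'q :: ab_group_add \<Rightarrow> (complex \<Rightarrow> 'v \<Rightarrow> 'v) \<Rightarrow> bool" where
  "is_field_of_charge scale Vgr \<Delta> \<alpha> a \<longleftrightarrow>
     (\<forall>n. Vector_Spaces.linear scale scale (a n)) \<and>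
     (\<forall>\<beta>. \<forall>b\<in>Vgr \<beta>. (\<lambda>x. zcoeff a x b) \<in> coset_series (Vgr (\<alpha> + \<beta>)) (- \<Delta> \<alpha> \<beta>))"

text \<open>\<open>N\<close> is a locality bound of \<open>a(z)\<close>, \<open>b(z)\<close>, fields of charges \<open>\<alpha>\<close>, \<open>\<beta>\<close>, for the factor \<open>p\<close>.\<close>

definition is_locality_bound ::
  "(complex \<Rightarrow> 'k) \<Rightarrow> ('k :: field \<Rightarrow> 'v \<Rightarrow> 'v) \<Rightarrow> ('q \<Rightarrow> 'q \<Rightarrow> complex_mod_int) \<Rightarrow> 'q \<Rightarrow> 'q \<Rightarrow> complex \<Rightarrow>
     (complex \<Rightarrow> 'v \<Rightarrow> 'v) \<Rightarrow> (complex \<Rightarrow> 'v \<Rightarrow> 'v :: ab_group_add) \<Rightarrow> complex \<Rightarrow> bool" where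
  "is_locality_bound emb scale \<Delta> \<alpha> \<beta> p a b N \<longleftrightarrow> int_coset N = \<Delta> \<alpha> \<beta> \<and>
     (\<forall>c x y. iota_zw_mult emb scale N (\<lambda>x y. zcoeff a x (zcoeff b y c)) x y =
        scale (emb p) (iota_wz_mult emb scale N (\<lambda>x y. zcoeff b y (zcoeff a x c)) x y))"

text \<open>A generalized vertex algebra together with a charge factor on the abelian group \<open>'q\<close>.\<close>

locale gva_charge_factor = weak_gva scale emb Y vac T
  for scale :: "'k :: field \<Rightarrow> 'v :: ab_group_add \<Rightarrow> 'v"
    and emb :: "complex \<Rightarrow> 'k"
    and Y :: "'v \<Rightarrow> complex \<Rightarrow> 'v \<Rightarrow> 'v"
    and vac :: 'v
    and T :: "'v \<Rightarrow> 'v" +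
  fixes Vgr :: "'q :: ab_group_add \<Rightarrow> 'v set"
    and \<Delta> :: "'q \<Rightarrow> 'q \<Rightarrow> complex_mod_int"
    and \<eta> :: "'q \<Rightarrow> 'q \<Rightarrow> complex"
  assumes \<Delta>_sym: "\<Delta> \<alpha> \<beta> = \<Delta> \<beta> \<alpha>"
    and \<Delta>_add: "\<Delta> (\<alpha> + \<beta>) \<gamma> = \<Delta> \<alpha> \<gamma> + \<Delta> \<beta> \<gamma>"
    and grading: "direct_sum_decomposition scale Vgr"
    and \<eta>_nonzero: "\<eta> \<alpha> \<beta> \<noteq> 0"
    and \<eta>_mult_left: "\<eta> (\<alpha> + \<beta>) \<gamma> = \<eta> \<alpha> \<gamma> * \<eta> \<beta> \<gamma>"
    and \<eta>_mult_right: "\<eta> \<alpha> (\<beta> + \<gamma>) = \<eta> \<alpha> \<beta> * \<eta> \<alpha> \<gamma>"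
    and \<eta>_\<Delta>: "\<eta> \<alpha> \<beta> * \<eta> \<beta> \<alpha> = exp_2pi_i (- \<Delta> \<alpha> \<beta>)"
    and vac_charge: "vac \<in> Vgr 0"
    and T_charge: "v \<in> Vgr \<alpha> \<Longrightarrow> T v \<in> Vgr \<alpha>"
    and Y_field: "a \<in> Vgr \<alpha> \<Longrightarrow> is_field_of_charge scale Vgr \<Delta> \<alpha> (Y a)"
    and Y_local: "a \<in> Vgr \<alpha> \<Longrightarrow> b \<in> Vgr \<beta> \<Longrightarrow>
      \<exists>N. is_locality_bound emb scale \<Delta> \<alpha> \<beta> (\<eta> \<alpha> \<beta>) (Y a) (Y b) N"

definition generated_subspace ::
  "('k :: field \<Rightarrow> 'v \<Rightarrow> 'v) \<Rightarrow> ('v \<Rightarrow> complex \<Rightarrow> 'v \<Rightarrow> 'v) \<Rightarrow> 'v \<Rightarrow> ('v \<Rightarrow> 'v) \<Rightarrow>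
     'v set \<Rightarrow> 'v :: ab_group_add set" where
  "generated_subspace scale Y vac T S =
     \<Inter>{W. module.subspace scale W \<and> T ` W \<subseteq> W \<and> S \<subseteq> W \<and> vac \<in> W \<and>
         (\<forall>u\<in>W. \<forall>v\<in>W. \<forall>n. Y u n v \<in> W)}"

text \<open>
  Finite sequences \<open>a\<^sub>1, \<dots>, a\<^sub>k\<close> and \<open>m\<^sub>1, \<dots>, m\<^sub>k\<close> are the restrictions to \<open>{..<k}\<close> of functions on
  \<open>nat\<close>, so the indices are shifted by one.
\<close>

primrec Psi :: "('v \<Rightarrow> complex \<Rightarrow> 'v \<Rightarrow> 'v) \<Rightarrow> 'v \<Rightarrow> ('b \<Rightarrow> 'v) \<Rightarrow> ('b \<Rightarrow> 'b \<Rightarrow> complex) \<Rightarrow>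
    (nat \<Rightarrow> 'b) \<Rightarrow> (nat \<Rightarrow> complex) \<Rightarrow> nat \<Rightarrow> 'v" where
  "Psi Y vac \<iota> \<N> a m 0 = vac"
| "Psi Y vac \<iota> \<N> a m (Suc k) =
     Y (\<iota> (a k)) (m k + (\<Sum>j<k. \<N> (a k) (a j))) (Psi Y vac \<iota> \<N> a m k)"

definition V_span :: "('k :: field \<Rightarrow> 'v \<Rightarrow> 'v) \<Rightarrow> ('v \<Rightarrow> complex \<Rightarrow> 'v \<Rightarrow> 'v) \<Rightarrow> 'v \<Rightarrow>
    ('b \<Rightarrow> 'v) \<Rightarrow> ('b \<Rightarrow> 'b \<Rightarrow> complex) \<Rightarrow> (nat \<Rightarrow> 'b) \<Rightarrow> nat \<Rightarrow> int \<Rightarrow> 'v :: ab_group_add set" where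
  "V_span scale Y vac \<iota> \<N> a k M = module.span scale
     {Psi Y vac \<iota> \<N> a (\<lambda>j. of_int (m j)) k | m :: nat \<Rightarrow> int. (\<Sum>j<k. m j) = M}"

definition C_set :: "('v \<Rightarrow> complex \<Rightarrow> 'v \<Rightarrow> 'v) \<Rightarrow> 'v \<Rightarrow>
    ('b \<Rightarrow> 'v) \<Rightarrow> ('b \<Rightarrow> 'b \<Rightarrow> complex) \<Rightarrow> (nat \<Rightarrow> 'b) \<Rightarrow> nat \<Rightarrow> int \<Rightarrow> 'v set" where
  "C_set Y vac \<iota> \<N> a k M =
     {Psi Y vac \<iota> \<N> a (\<lambda>j. of_int (m j)) k | m :: nat \<Rightarrow> int.
        (\<Sum>j<k. m j) = M \<and> (\<forall>j<k. m j < 0) \<and>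
        (\<forall>i j. i < j \<and> j < k \<and> a i = a j \<longrightarrow> m j \<le> m i)}"

end

(*
  The product of a_k(z_k) ... a_1(z_1)|0> with all (z_i - z_j)^N(a_i, a_j), j < i, is by locality
  symmetric up to scalars under permutations of the fields. Since every field can be moved next to
  |0>, the product is a power series: its coefficients Phi(q) vanish unless all q_i >= 0.
  Expanding the factors (1 - z_j/z_i)^N shows that Phi(q) equals Psi(q), with q = -m-1, up to terms
  Psi(r), where r arises from q by moving weight from positions j to positions i > j; this keeps the
  total and lowers the sum of all proper partial sums. By induction on that sum, Psi(q) vanishes if
  the total of q is negative. Exchanging two equal neighbouring fields with q_p > q_{p+1} also lowers
  the sum and changes Phi only by a scalar, so the Psi(q) with q >= 0 sorted within blocks span.
*)

theory Submission
  imports Defs "HOL-Combinatorics.Transposition"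
begin

section \<open>Moving weight between exponents\<close>

text \<open>The coefficient at \<open>q\<close> of \<open>(z_j / z_i)^n\<close> times a series is
  the coefficient of that series at \<open>shift i j n q\<close>.\<close>

definition shift :: "nat \<Rightarrow> nat \<Rightarrow> nat \<Rightarrow> (nat \<Rightarrow> int) \<Rightarrow> nat \<Rightarrow> int" where
  "shift i j n q = (\<lambda>x. q x + (if x = i then int n else 0) - (if x = j then int n else 0))"

lemma shift_0 [simp]: "shift i j 0 q = q"
  by (auto simp: shift_def)

lemma shift_commute: "shift i j n (shift i' j' n' q) = shift i' j' n' (shift i j n q)"
  by (auto simp: shift_def)

lemma shift_comp_involution:
  assumes "\<And>x. s (s x) = x"
  shows "shift i j n q \<circ> s = shift (s i) (s j) n (q \<circ> s)"
proof -
  have "s x = y \<longleftrightarrow> x = s y" for x y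
    using assms by metis
  then show ?thesis
    by (auto simp: shift_def fun_eq_iff)
qed

lemma sum_shift:
  assumes "i < k" "j < k"
  shows "(\<Sum>x<k. shift i j n q x) = (\<Sum>x<k. q x)"
  using assms by (simp add: shift_def sum.distrib sum_subtractf)

text \<open>The induction measure. Entry \<open>q x\<close> is counted \<open>k - 1 - x\<close>
  times, so weight costs less the further right it sits.\<close>

definition partial_sums_total :: "nat \<Rightarrow> (nat \<Rightarrow> int) \<Rightarrow> int" where
  "partial_sums_total k q = (\<Sum>l<k. \<Sum>x<l. q x)"

lemma partial_sums_total_Suc:
  "partial_sums_total (Suc k) q = partial_sums_total k q + (\<Sum>x<k. q x)"
  by (simp add: partial_sums_total_def)

lemma partial_sums_total_cong:
  "(\<And>j. j < k \<Longrightarrow> q j = r j) \<Longrightarrow> partial_sums_total k q = partial_sums_total k r"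
  unfolding partial_sums_total_def by (intro sum.cong) auto

text \<open>Exactly the partial sums that contain position \<open>j\<close> but not
  \<open>i\<close>, those with \<open>j < l \<le> i\<close>, lose \<open>n\<close>;
  \<open>l = i\<close> is one of them.\<close>

lemma partial_sums_total_shift:
  assumes "j < i" "i < k" "0 < n"
  shows "partial_sums_total k (shift i j n q) < partial_sums_total k q"
proof -
  have *: "(\<Sum>x<l. shift i j n q x) = (\<Sum>x<l. q x) - (if j < l \<and> l \<le> i then int n else 0)" for l
    using assms by (auto simp: shift_def sum.distrib sum_subtractf)
  show ?thesis
    unfolding partial_sums_total_def *
  proof (rule sum_strict_mono_ex1)
    show "\<exists>l\<in>{..<k}. (\<Sum>x<l. q x) - (if j < l \<and> l \<le> i then int n else 0) < (\<Sum>x<l. q x)"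
      using assms by (intro bexI[of _ i]) auto
  qed auto
qed

text \<open>Sorting a descent is thus itself a move of weight to the right, to which
  \<open>sum_shift\<close> and \<open>partial_sums_total_shift\<close> apply.\<close>

lemma swap_eq_shift:
  assumes "q (Suc p) \<le> q p"
  shows "q \<circ> transpose p (Suc p) = shift (Suc p) p (nat (q p - q (Suc p))) q"
  using assms by (auto simp: shift_def fun_eq_iff transpose_def)

definition depends_below :: "nat \<Rightarrow> ((nat \<Rightarrow> 'c) \<Rightarrow> 'd) \<Rightarrow> bool" where
  "depends_below k F \<longleftrightarrow> (\<forall>q r. (\<forall>j<k. q j = r j) \<longrightarrow> F q = F r)"

lemma depends_belowD:
  "depends_below k F \<Longrightarrow> (\<And>j. j < k \<Longrightarrow> q j = r j) \<Longrightarrow> F q = F r"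
  unfolding depends_below_def by blast

section \<open>Formal multiplication by powers of 1 - z_j / z_i\<close>

context weak_gva
begin

lemma Y_sum: "Y u n (\<Sum>i\<in>A. f i) = (\<Sum>i\<in>A. Y u n (f i))"
  and Y_scale: "Y u n (scale c v) = scale c (Y u n v)"
  and Y_zero [simp]: "Y u n 0 = 0"
  and Y_diff: "Y u n (v - w) = Y u n v - Y u n w"
proof -
  interpret Y: Vector_Spaces.linear scale scale "Y u n"
    by (rule Y_endo)
  show "Y u n (\<Sum>i\<in>A. f i) = (\<Sum>i\<in>A. Y u n (f i))" "Y u n (scale c v) = scale c (Y u n v)"
    "Y u n 0 = 0" "Y u n (v - w) = Y u n v - Y u n w"
    by (fact Y.sum Y.scale Y.zero Y.diff)+
qed

lemma Y_span: "v \<in> span S \<Longrightarrow> Y u n v \<in> span (Y u n ` S)"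
proof -
  interpret Y: Vector_Spaces.linear scale scale "Y u n"
    by (rule Y_endo)
  show "v \<in> span S \<Longrightarrow> Y u n v \<in> span (Y u n ` S)"
    by (simp add: Y.span_image)
qed

text \<open>
  The action of \<open>(1 - z\<^sub>j / z\<^sub>i)\<close> to the power \<open>N\<close> on families of coefficients.  The sum is cut off so
  that it is finite for every \<open>F\<close>; this is harmless if \<open>F q = 0\<close> whenever \<open>q j < 0\<close>.
\<close>

definition binom_mult ::
  "nat \<Rightarrow> nat \<Rightarrow> complex \<Rightarrow> ((nat \<Rightarrow> int) \<Rightarrow> 'v) \<Rightarrow> (nat \<Rightarrow> int) \<Rightarrow> 'v" where
  "binom_mult i j N F q =
     (\<Sum>n\<le>nat (q j). scale (emb ((N gchoose n) * (-1) ^ n)) (F (shift i j n q)))"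

text \<open>Multiplication by the product over \<open>j < n\<close> of
  \<open>(1 - z_j / z_i)\<close> to the power \<open>\<nu> j\<close>, with common target
  \<open>i\<close>.\<close>

primrec binom_mults ::
  "nat \<Rightarrow> (nat \<Rightarrow> complex) \<Rightarrow> nat \<Rightarrow> ((nat \<Rightarrow> int) \<Rightarrow> 'v) \<Rightarrow> (nat \<Rightarrow> int) \<Rightarrow> 'v" where
  "binom_mults i \<nu> 0 F = F"
| "binom_mults i \<nu> (Suc n) F = binom_mults i \<nu> n (binom_mult i n (\<nu> n) F)"

lemma binom_mults_cong:
  "(\<And>j. j < n \<Longrightarrow> \<nu> j = \<mu> j) \<Longrightarrow> binom_mults i \<nu> n F = binom_mults i \<mu> n F"
  by (induction n arbitrary: F) auto

text \<open>The cut-offs depend on the index and not on the family, so a fixed coefficient involves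
  finitely many entries. This gives \<open>Phi_Suc_Suc\<close> one summation length valid for all of
  them.\<close>

lemma binom_mults_finite_dependence:
  "\<exists>R. finite R \<and> (\<forall>F G. (\<forall>r\<in>R. F r = G r) \<longrightarrow> binom_mults i \<nu> n F q = binom_mults i \<nu> n G q)"
proof (induction n)
  case 0
  show ?case by (rule exI[of _ "{q}"]) simp
next
  case (Suc n)
  then obtain R where R: "finite R"
    "\<forall>F G. (\<forall>r\<in>R. F r = G r) \<longrightarrow> binom_mults i \<nu> n F q = binom_mults i \<nu> n G q"
    by (elim exE conjE)
  show ?case
  proof (intro exI[of _ "\<Union>r\<in>R. (\<lambda>m. shift i n m r) ` {..nat (r n)}"] conjI allI impI)
    show "finite (\<Union>r\<in>R. (\<lambda>m. shift i n m r) ` {..nat (r n)})"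
      using R(1) by blast
    fix F G :: "(nat \<Rightarrow> int) \<Rightarrow> 'v"
    assume "\<forall>r\<in>\<Union>r\<in>R. (\<lambda>m. shift i n m r) ` {..nat (r n)}. F r = G r"
    then have "binom_mult i n (\<nu> n) F r = binom_mult i n (\<nu> n) G r" if "r \<in> R" for r
      using that unfolding binom_mult_def by (intro sum.cong) auto
    then show "binom_mults i \<nu> (Suc n) F q = binom_mults i \<nu> (Suc n) G q"
      using R(2) by simp
  qed
qed

lemma binom_mults_sum:
  "binom_mults i \<nu> n (\<lambda>r. \<Sum>l\<in>S. scale (x l) (F l r)) =
     (\<lambda>q. \<Sum>l\<in>S. scale (x l) (binom_mults i \<nu> n (F l) q))"
proof (induction n arbitrary: F)
  case (Suc n)
  have "binom_mult i n (\<nu> n) (\<lambda>r. \<Sum>l\<in>S. scale (x l) (F l r)) =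
      (\<lambda>r. \<Sum>l\<in>S. scale (x l) (binom_mult i n (\<nu> n) (F l) r))"
  proof
    fix r
    show "binom_mult i n (\<nu> n) (\<lambda>r. \<Sum>l\<in>S. scale (x l) (F l r)) r =
        (\<Sum>l\<in>S. scale (x l) (binom_mult i n (\<nu> n) (F l) r))"
      unfolding binom_mult_def scale_sum_right
      by (subst sum.swap) (simp add: mult.commute)
  qed
  then show ?case
    using Suc.IH[of "\<lambda>l. binom_mult i n (\<nu> n) (F l)"] by simp
qed simp

lemma binom_mults_scale:
  "binom_mults i \<nu> n (\<lambda>r. scale c (F r)) = (\<lambda>q. scale c (binom_mults i \<nu> n F q))"
  using binom_mults_sum[of i \<nu> n "\<lambda>_. c" "\<lambda>_. F" "{()}"] by simp

text \<open>The shifts involved never touch position \<open>k\<close>, so the mode index is constant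
  along each sum and the operator can be pulled out.\<close>

lemma binom_mults_Y:
  assumes "n \<le> k" "i \<noteq> k"
  shows "binom_mults i \<nu> n (\<lambda>r. Y u (g (r k)) (F r)) = (\<lambda>q. Y u (g (q k)) (binom_mults i \<nu> n F q))"
  using assms(1)
proof (induction n arbitrary: F)
  case (Suc n)
  have "shift i n m r k = r k" for m r
    using Suc.prems assms(2) by (simp add: shift_def)
  then have "binom_mult i n (\<nu> n) (\<lambda>r. Y u (g (r k)) (F r)) =
      (\<lambda>r. Y u (g (r k)) (binom_mult i n (\<nu> n) F r))"
    by (auto simp: binom_mult_def Y_sum Y_scale)
  with Suc show ?case by simp
qed simp

text \<open>The cut-offs read only positions below \<open>n\<close>, which a shift between positions
  from \<open>n\<close> on leaves alone.\<close>

lemma binom_mults_shift: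
  assumes "n \<le> i'" "n \<le> j'"
  shows "binom_mults i \<nu> n (\<lambda>r. F (shift i' j' m r)) = (\<lambda>q. binom_mults i \<nu> n F (shift i' j' m q))"
  using assms
proof (induction n arbitrary: F)
  case (Suc n)
  have "shift i' j' m r n = r n" for r
    using Suc.prems by (simp add: shift_def)
  then have "binom_mult i n (\<nu> n) (\<lambda>r. F (shift i' j' m r)) =
      (\<lambda>r. binom_mult i n (\<nu> n) F (shift i' j' m r))"
    by (auto simp: binom_mult_def shift_commute)
  with Suc show ?case by simp
qed simp

text \<open>Shifts commute, so only the cut-offs matter. The assumptions keep each target distinct
  from both sources, so neither operator can lengthen the sum of the other.\<close>

lemma binom_mult_commute:
  assumes "i \<noteq> j" "i \<noteq> j'" "i' \<noteq> j" "i' \<noteq> j'"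
  shows "binom_mult i j N (binom_mult i' j' N' F) = binom_mult i' j' N' (binom_mult i j N F)"
proof
  fix q
  let ?c = "\<lambda>N n. emb ((N gchoose n) * (-1) ^ n)"
  let ?f = "\<lambda>n n'. scale (?c N n * ?c N' n') (F (shift i j n (shift i' j' n' q)))"
  show "binom_mult i j N (binom_mult i' j' N' F) q = binom_mult i' j' N' (binom_mult i j N F) q"
  proof (cases "j = j'")
    case False
    then have "shift i j n q j' = q j'" "shift i' j' n q j = q j" for n
      using assms by (auto simp: shift_def)
    then have "binom_mult i j N (binom_mult i' j' N' F) q = (\<Sum>n\<le>nat (q j). \<Sum>n'\<le>nat (q j'). ?f n n')"
      "binom_mult i' j' N' (binom_mult i j N F) q = (\<Sum>n'\<le>nat (q j'). \<Sum>n\<le>nat (q j). ?f n n')"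
      by (auto simp: binom_mult_def scale_sum_right shift_commute[of i' j'] mult_ac)
    then show ?thesis
      by (simp add: sum.swap[of _ "{..nat (q j)}"])
  next
    case True
    \<comment> \<open>With a common source, the inner operator sees position \<open>j\<close>
      already lowered by the outer one. Both orders therefore sum over the triangle
      \<open>n + n' \<le> ?Q\<close>.\<close>
    let ?Q = "nat (q j)"
    have "nat (shift i j n q j') = ?Q - n" "nat (shift i' j' n q j) = ?Q - n" for n
      using assms True by (auto simp: shift_def)
    then have *: "binom_mult i j N (binom_mult i' j' N' F) q = (\<Sum>n\<le>?Q. \<Sum>n'\<le>?Q - n. ?f n n')"
      "binom_mult i' j' N' (binom_mult i j N F) q = (\<Sum>n'\<le>?Q. \<Sum>n\<le>?Q - n'. ?f n n')"
      using True by (auto simp: binom_mult_def scale_sum_right shift_commute[of i' j'] mult_ac)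
    have "(\<Sum>n\<le>?Q. \<Sum>n'\<le>?Q - n. ?f n n') = (\<Sum>(n, n')\<in>Sigma {..?Q} (\<lambda>n. {..?Q - n}). ?f n n')"
      by (simp add: sum.Sigma)
    also have "\<dots> = (\<Sum>(n', n)\<in>Sigma {..?Q} (\<lambda>n. {..?Q - n}). ?f n n')"
      by (rule sum.reindex_bij_witness[of _ prod.swap prod.swap]) auto
    also have "\<dots> = (\<Sum>n'\<le>?Q. \<Sum>n\<le>?Q - n'. ?f n n')"
      by (simp add: sum.Sigma)
    finally show ?thesis
      using * by simp
  qed
qed

lemma binom_mult_mults_commute:
  assumes "i \<noteq> j" "i' \<noteq> j" "n \<le> i" "n \<le> i'"
  shows "binom_mult i j N (binom_mults i' \<nu> n F) = binom_mults i' \<nu> n (binom_mult i j N F)"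
  using assms by (induction n arbitrary: F) (auto simp: binom_mult_commute)

lemma binom_mults_commute:
  assumes "n \<le> i" "n \<le> i'" "n' \<le> i" "n' \<le> i'"
  shows "binom_mults i \<nu> n (binom_mults i' \<nu>' n' F) = binom_mults i' \<nu>' n' (binom_mults i \<nu> n F)"
  using assms by (induction n arbitrary: F) (auto simp: binom_mult_mults_commute)

lemma binom_mult_involution:
  assumes "\<And>x. s (s x) = x"
  shows "binom_mult i j N (\<lambda>r. F (r \<circ> s)) = (\<lambda>q. binom_mult (s i) (s j) N F (q \<circ> s))"
  using assms by (auto simp: binom_mult_def shift_comp_involution[OF assms])

text \<open>All sources lie below \<open>p\<close> and are fixed by \<open>s\<close>; only the
  target is relabelled.\<close>

lemma binom_mults_swap_above:
  assumes "n \<le> p" and s: "s = transpose p (Suc p)"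
  shows "binom_mults i \<nu> n (\<lambda>r. F (r \<circ> s)) = (\<lambda>q. binom_mults (s i) \<nu> n F (q \<circ> s))"
  using assms(1)
proof (induction n arbitrary: F)
  case (Suc n)
  have "s n = n"
    using Suc.prems by (simp add: s transpose_def)
  then have "binom_mult i n (\<nu> n) (\<lambda>r. F (r \<circ> s)) = (\<lambda>q. binom_mult (s i) n (\<nu> n) F (q \<circ> s))"
    by (subst binom_mult_involution) (auto simp: s)
  with Suc show ?case by (simp add: o_def)
qed simp

text \<open>The swap exchanges the factors with sources \<open>p\<close> and \<open>Suc p\<close>.
  Their exponents agree and they commute, so the product is unchanged.\<close>

lemma binom_mults_swap_inside:
  assumes "Suc p < n" "n \<le> i" "\<nu> p = \<nu> (Suc p)" and s: "s = transpose p (Suc p)"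
  shows "binom_mults i \<nu> n (\<lambda>r. F (r \<circ> s)) = (\<lambda>q. binom_mults i \<nu> n F (q \<circ> s))"
  using assms(1,2)
proof (induction n arbitrary: F)
  case (Suc n)
  have ss: "s (s x) = x" for x
    by (simp add: s)
  have si: "s i = i"
    using Suc.prems by (simp add: s transpose_def)
  show ?case
  proof (cases "n = Suc p")
    case True
    have "binom_mults i \<nu> (Suc n) (\<lambda>r. F (r \<circ> s)) =
        binom_mults i \<nu> p (binom_mult i p (\<nu> p) (binom_mult i (Suc p) (\<nu> p) (\<lambda>r. F (r \<circ> s))))"
      using True assms(3) by simp
    also have "\<dots> = binom_mults i \<nu> p (\<lambda>q. binom_mult i (Suc p) (\<nu> p) (binom_mult i p (\<nu> p) F) (q \<circ> s))"
      by (subst binom_mult_involution[OF ss], subst binom_mult_involution[OF ss]) (simp add: si, simp add: s)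
    also have "\<dots> = (\<lambda>q. binom_mults i \<nu> p (binom_mult i (Suc p) (\<nu> p) (binom_mult i p (\<nu> p) F)) (q \<circ> s))"
      by (subst binom_mults_swap_above[OF order_refl s]) (simp add: si)
    also have "binom_mult i (Suc p) (\<nu> p) (binom_mult i p (\<nu> p) F) =
        binom_mult i p (\<nu> p) (binom_mult i (Suc p) (\<nu> p) F)"
      using Suc.prems by (intro binom_mult_commute) auto
    finally show ?thesis
      using True assms(3) by simp
  next
    case False
    then have "s n = n"
      using Suc.prems by (simp add: s transpose_def)
    then have "binom_mult i n (\<nu> n) (\<lambda>r. F (r \<circ> s)) = (\<lambda>q. binom_mult i n (\<nu> n) F (q \<circ> s))"
      by (subst binom_mult_involution[OF ss]) (simp add: si)
    with Suc False show ?thesis by (simp add: o_def)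
  qed
qed simp

text \<open>Only the target \<open>i\<close> gains weight, so a negative entry elsewhere stays
  negative in every term.\<close>

lemma binom_mults_vanish:
  assumes "\<And>q. q j < 0 \<Longrightarrow> F q = 0" "j \<noteq> i" "q j < 0"
  shows "binom_mults i \<nu> n F q = 0"
  using assms(1)
proof (induction n arbitrary: F)
  case (Suc n)
  have "binom_mult i n (\<nu> n) F r = 0" if "r j < 0" for r
  proof -
    have "shift i n m r j < 0" for m
      using that assms(2) by (auto simp: shift_def)
    then show ?thesis
      by (simp add: binom_mult_def Suc.prems)
  qed
  with Suc.IH show ?case by simp
qed (use assms in simp)

lemma binom_mults_depends_below:
  assumes "depends_below k F" "i < k" "n \<le> k"
  shows "depends_below k (binom_mults i \<nu> n F)"
  using assms(1,3)
proof (induction n arbitrary: F)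
  case (Suc n)
  have "depends_below k (binom_mult i n (\<nu> n) F)"
    unfolding depends_below_def
  proof (intro allI impI)
    fix q r :: "nat \<Rightarrow> int"
    assume eq: "\<forall>j<k. q j = r j"
    have "F (shift i n m q) = F (shift i n m r)" for m
      using Suc.prems(1) by (rule depends_belowD) (use eq in \<open>simp add: shift_def\<close>)
    moreover have "q n = r n"
      using eq Suc.prems by simp
    ultimately show "binom_mult i n (\<nu> n) F q = binom_mult i n (\<nu> n) F r"
      by (simp add: binom_mult_def)
  qed
  with Suc show ?case by simp
qed simp

end

section \<open>Truncation of the fields of homogeneous vectors\<close>

locale gva_generators = gva_charge_factor scale emb Y vac T Vgr \<Delta> \<eta>
  for scale :: "'k :: field \<Rightarrow> 'v :: ab_group_add \<Rightarrow> 'v"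
    and emb :: "complex \<Rightarrow> 'k"
    and Y :: "'v \<Rightarrow> complex \<Rightarrow> 'v \<Rightarrow> 'v"
    and vac :: 'v
    and T :: "'v \<Rightarrow> 'v"
    and Vgr :: "'q :: ab_group_add \<Rightarrow> 'v set"
    and \<Delta> :: "'q \<Rightarrow> 'q \<Rightarrow> complex_mod_int"
    and \<eta> :: "'q \<Rightarrow> 'q \<Rightarrow> complex" +
  fixes B :: "'b set"
    and \<iota> :: "'b \<Rightarrow> 'v"
    and \<N> :: "'b \<Rightarrow> 'b \<Rightarrow> complex"
  assumes homogeneous: "b \<in> B \<Longrightarrow> \<exists>\<alpha>. \<iota> b \<in> Vgr \<alpha>"
    and N_sym: "b \<in> B \<Longrightarrow> c \<in> B \<Longrightarrow> \<N> b c = \<N> c b"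
    and N_bound: "b \<in> B \<Longrightarrow> c \<in> B \<Longrightarrow> \<iota> b \<in> Vgr \<alpha> \<Longrightarrow> \<iota> c \<in> Vgr \<beta> \<Longrightarrow>
      is_locality_bound emb scale \<Delta> \<alpha> \<beta> (\<eta> \<alpha> \<beta>) (Y (\<iota> b)) (Y (\<iota> c)) (\<N> b c)"
begin

lemma shifted_series_truncated: "\<exists>L. \<forall>l>L. shifted_series \<psi> d (y - of_nat l) = 0"
proof (cases "\<exists>l::nat. y - of_nat l - d \<in> \<nat>")
  case True
  then obtain l m :: nat where lm: "y - of_nat l - d = of_nat m"
    by (auto elim: Nats_cases)
  have "shifted_series \<psi> d (y - of_nat n) = 0" if "n > l + m" for n
  proof -
    have "y - of_nat n - d \<noteq> of_nat m'" for m'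
    proof
      assume "y - of_nat n - d = of_nat m'"
      with lm have "(of_nat (l + m) :: complex) = of_nat (n + m')"
        by (simp add: algebra_simps)
      then show False
        using that by (simp only: of_nat_eq_iff)
    qed
    then show ?thesis
      by (auto simp: shifted_series_def elim: Nats_cases)
  qed
  then show ?thesis by blast
qed (auto simp: shifted_series_def)

lemma homogeneous_truncated:
  assumes "u \<in> Vgr \<alpha>" "v \<in> Vgr \<beta>"
  shows "\<exists>L. \<forall>l>L. zcoeff (Y u) (y - of_nat l) v = 0"
proof -
  have "(\<lambda>x. zcoeff (Y u) x v) \<in> coset_series (Vgr (\<alpha> + \<beta>)) (- \<Delta> \<alpha> \<beta>)"
    using Y_field[OF assms(1)] assms(2) by (simp add: is_field_of_charge_def)
  then obtain D \<psi> where D: "finite D"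
    and eq: "(\<lambda>x. zcoeff (Y u) x v) = (\<lambda>x. \<Sum>d\<in>D. shifted_series (\<psi> d) d x)"
    by (auto simp: coset_series_def)
  have "\<forall>d. \<exists>L. \<forall>l>L. shifted_series (\<psi> d) d (y - of_nat l) = 0"
    using shifted_series_truncated by blast
  from choice[OF this] obtain L
    where L: "\<And>d l. l > L d \<Longrightarrow> shifted_series (\<psi> d) d (y - of_nat l) = 0"
    by blast
  have "zcoeff (Y u) (y - of_nat l) v = 0" if "l > Max (L ` D)" for l
  proof -
    have "L d < l" if "d \<in> D" for d
      using that \<open>l > Max (L ` D)\<close> D by (meson Max_ge finite_imageI image_eqI le_less_trans)
    then show ?thesis
      using fun_cong[OF eq, of "y - of_nat l"] L by simp
  qed
  then show ?thesis by blast
qed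

text \<open>A general \<open>v\<close> has finitely many homogeneous components; the largest of
  their bounds works.\<close>

lemma truncated:
  assumes "u \<in> Vgr \<alpha>"
  shows "\<exists>L. \<forall>l>L. zcoeff (Y u) (y - of_nat l) v = 0"
proof -
  obtain f where f: "finite {\<beta>. f \<beta> \<noteq> 0}" "\<And>\<beta>. f \<beta> \<in> Vgr \<beta>" "v = Sum_any f"
    using grading unfolding direct_sum_decomposition_def by metis
  obtain L where L: "\<And>\<beta> l. l > L \<beta> \<Longrightarrow> zcoeff (Y u) (y - of_nat l) (f \<beta>) = 0"
    using homogeneous_truncated[OF assms f(2)] by metis
  have "zcoeff (Y u) (y - of_nat l) v = 0" if "l > Max (L ` {\<beta>. f \<beta> \<noteq> 0})" for l
  proof -
    have "zcoeff (Y u) (y - of_nat l) v = (\<Sum>\<beta> | f \<beta> \<noteq> 0. zcoeff (Y u) (y - of_nat l) (f \<beta>))"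
      by (simp add: f(3) Sum_any.expand_set zcoeff_def Y_sum)
    also have "\<dots> = 0"
    proof (rule sum.neutral, rule ballI)
      fix \<beta> assume "\<beta> \<in> {\<beta>. f \<beta> \<noteq> 0}"
      then have "L \<beta> < l"
        using that f(1) by (meson Max_ge finite_imageI image_eqI le_less_trans)
      then show "zcoeff (Y u) (y - of_nat l) (f \<beta>) = 0"
        by (rule L)
    qed
    finally show ?thesis .
  qed
  then show ?thesis by blast
qed

section \<open>Coefficients of products of fields\<close>

text \<open>In \<open>(z_k - z_j)^N = z_k^N (1 - z_j / z_k)^N\<close> the monomial is absorbed here:
  this mode extracts the coefficient of \<open>z_k^x\<close> after multiplication by all
  \<open>z_k^N\<close>. Only the binomial parts remain for \<open>binom_mults\<close>.\<close>

definition mode :: "(nat \<Rightarrow> 'b) \<Rightarrow> nat \<Rightarrow> int \<Rightarrow> complex" where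
  "mode a k x = of_int (- x - 1) + (\<Sum>j<k. \<N> (a k) (a j))"

text \<open>
  In the notation of the paper, with indices shifted by one, \<open>Phi a k q\<close> is the coefficient of the
  monomial \<open>\<Prod>i. z\<^sub>i\<close> with exponents \<open>q i\<close> in the product of \<open>a\<^sub>k(z\<^sub>k) \<cdots> a\<^sub>1(z\<^sub>1)|0\<rangle>\<close> with all
  \<open>(z\<^sub>i - z\<^sub>j)\<close> to the power \<open>\<N>(a\<^sub>i, a\<^sub>j)\<close>, \<open>j < i\<close>, expanded in the domain \<open>\<bar>z\<^sub>i\<bar> > \<bar>z\<^sub>j\<bar>\<close>;
  \<open>Psi_coeff\<close> is \<open>Psi\<close> with \<open>q = - m - 1\<close>.
\<close>

primrec Phi :: "(nat \<Rightarrow> 'b) \<Rightarrow> nat \<Rightarrow> (nat \<Rightarrow> int) \<Rightarrow> 'v" where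
  "Phi a 0 = (\<lambda>q. vac)"
| "Phi a (Suc k) = binom_mults k (\<lambda>j. \<N> (a k) (a j)) k
     (\<lambda>q. Y (\<iota> (a k)) (mode a k (q k)) (Phi a k q))"

definition Psi_coeff :: "(nat \<Rightarrow> 'b) \<Rightarrow> nat \<Rightarrow> (nat \<Rightarrow> int) \<Rightarrow> 'v" where
  "Psi_coeff a k q = Psi Y vac \<iota> \<N> a (\<lambda>j. of_int (- q j - 1)) k"

lemma Psi_coeff_0 [simp]: "Psi_coeff a 0 q = vac"
  and Psi_coeff_Suc [simp]:
    "Psi_coeff a (Suc k) q = Y (\<iota> (a k)) (mode a k (q k)) (Psi_coeff a k q)"
  by (simp_all add: Psi_coeff_def mode_def)

lemma Phi_cong: "(\<And>j. j < k \<Longrightarrow> a j = a' j) \<Longrightarrow> Phi a k = Phi a' k"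
proof (induction k)
  case (Suc k)
  then have "mode a k = mode a' k"
    by (auto simp: mode_def fun_eq_iff)
  moreover have "binom_mults k (\<lambda>j. \<N> (a' k) (a j)) k F = binom_mults k (\<lambda>j. \<N> (a' k) (a' j)) k F" for F
    using Suc.prems by (intro binom_mults_cong) auto
  ultimately show ?case
    using Suc by simp
qed simp

lemma Phi_depends_below: "depends_below k (Phi a k)"
proof (induction k)
  case (Suc k)
  have "depends_below (Suc k) (\<lambda>q. Y (\<iota> (a k)) (mode a k (q k)) (Phi a k q))"
    unfolding depends_below_def
  proof (intro allI impI)
    fix q r :: "nat \<Rightarrow> int"
    assume "\<forall>j<Suc k. q j = r j"
    then show "Y (\<iota> (a k)) (mode a k (q k)) (Phi a k q) = Y (\<iota> (a k)) (mode a k (r k)) (Phi a k r)"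
      using depends_belowD[OF Suc, of q r] by simp
  qed
  then show ?case
    by (simp add: binom_mults_depends_below)
qed (simp add: depends_below_def)

lemma Psi_coeff_depends_below: "depends_below k (Psi_coeff a k)"
proof (induction k)
  case (Suc k)
  show ?case
    unfolding depends_below_def
    using depends_belowD[OF Suc] by (metis Psi_coeff_Suc lessI less_Suc_eq)
qed (simp add: depends_below_def)

section \<open>Exchanging the two outermost fields\<close>

text \<open>The two outermost fields with their mutual factor, to which locality applies directly.
  Of their factors with the inner fields only the monomials are included, as offsets of the
  exponents; the binomial parts are left out.\<close>

definition top_pair :: "(nat \<Rightarrow> 'b) \<Rightarrow> nat \<Rightarrow> (nat \<Rightarrow> int) \<Rightarrow> 'v" where
  "top_pair a k r = iota_zw_mult emb scale (\<N> (a (Suc k)) (a k))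
     (\<lambda>x y. zcoeff (Y (\<iota> (a (Suc k)))) x (zcoeff (Y (\<iota> (a k))) y (Phi a k r)))
     (of_int (r (Suc k)) - (\<Sum>j<k. \<N> (a (Suc k)) (a j))) (of_int (r k) - (\<Sum>j<k. \<N> (a k) (a j)))"

text \<open>Truncation makes the support finite, so \<open>Sum_any\<close> is the true sum and not
  its default 0. Every \<open>L \<ge> L0\<close> is allowed so that one \<open>L\<close> can serve
  several \<open>r\<close>.\<close>

lemma top_pair_finite_sum:
  assumes "a k \<in> B"
  shows "\<exists>L0. \<forall>L\<ge>L0. top_pair a k r =
    (\<Sum>l\<le>L. scale (emb ((\<N> (a (Suc k)) (a k) gchoose l) * (-1) ^ l))
      (Y (\<iota> (a (Suc k))) (mode a (Suc k) (r (Suc k) + int l))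
        (Y (\<iota> (a k)) (mode a k (r k - int l)) (Phi a k r))))"
proof -
  define N where "N = \<N> (a (Suc k)) (a k)"
  define y where "y = of_int (r k) - (\<Sum>j<k. \<N> (a k) (a j))"
  define x where "x = of_int (r (Suc k)) - (\<Sum>j<k. \<N> (a (Suc k)) (a j))"
  define t where "t = (\<lambda>l. scale (emb ((N gchoose l) * (-1) ^ l))
     (zcoeff (Y (\<iota> (a (Suc k)))) (x - (N - of_nat l))
       (zcoeff (Y (\<iota> (a k))) (y - of_nat l) (Phi a k r))))"
  obtain L0 where L0: "\<And>l. l > L0 \<Longrightarrow> zcoeff (Y (\<iota> (a k))) (y - of_nat l) (Phi a k r) = 0"
    using homogeneous[OF assms] truncated by metis
  have t0: "t l = 0" if "l > L0" for l
    using L0[OF that] by (simp add: t_def zcoeff_def)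
  have "t l = scale (emb ((N gchoose l) * (-1) ^ l))
      (Y (\<iota> (a (Suc k))) (mode a (Suc k) (r (Suc k) + int l))
        (Y (\<iota> (a k)) (mode a k (r k - int l)) (Phi a k r)))" for l
    by (simp add: t_def zcoeff_def x_def y_def N_def mode_def algebra_simps)
  moreover have "top_pair a k r = (\<Sum>l\<le>L. t l)" if "L \<ge> L0" for L
  proof -
    have "top_pair a k r = Sum_any t"
      by (simp add: top_pair_def iota_zw_mult_def t_def x_def y_def N_def)
    also have "\<dots> = (\<Sum>l\<le>L. t l)"
    proof (rule Sum_any.expand_superset)
      show "{l. t l \<noteq> 0} \<subseteq> {..L}"
        using t0 that by (force simp: not_less[symmetric])
    qed simp
    finally show ?thesis .
  qed
  ultimately show ?thesis
    by (auto simp: N_def)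
qed

text \<open>This is locality. The expansion \<open>iota_wz_mult\<close> is a phase times
  \<open>iota_zw_mult\<close> with the variables exchanged, so the other side is a multiple of the
  top pair of the swapped sequence, by a scalar independent of \<open>r\<close>.\<close>

lemma top_pair_swap:
  assumes "a k \<in> B" "a (Suc k) \<in> B"
  shows "\<exists>c. \<forall>r. top_pair a k r =
    scale c (top_pair (a \<circ> transpose k (Suc k)) k (r \<circ> transpose k (Suc k)))"
proof -
  let ?s = "transpose k (Suc k)"
  obtain \<alpha> \<beta> where \<alpha>: "\<iota> (a (Suc k)) \<in> Vgr \<alpha>" and \<beta>: "\<iota> (a k) \<in> Vgr \<beta>"
    using homogeneous assms by blast
  have loc: "iota_zw_mult emb scale N (\<lambda>x y. zcoeff (Y (\<iota> (a (Suc k)))) x (zcoeff (Y (\<iota> (a k))) y c)) x y =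
      scale (emb (\<eta> \<alpha> \<beta>))
        (iota_wz_mult emb scale N (\<lambda>x y. zcoeff (Y (\<iota> (a k))) y (zcoeff (Y (\<iota> (a (Suc k)))) x c)) x y)"
    if "N = \<N> (a (Suc k)) (a k)" for c x y N
    using N_bound[OF assms(2,1) \<alpha> \<beta>] that by (simp add: is_locality_bound_def)
  have [simp]: "?s j = j" if "j < k" for j
    using that by (simp add: transpose_def)
  have sums: "(\<Sum>j<k. \<N> b ((a \<circ> ?s) j)) = (\<Sum>j<k. \<N> b (a j))" for b
    by (intro sum.cong) auto
  have Phi: "Phi (a \<circ> ?s) k (r \<circ> ?s) = Phi a k r" for r
  proof -
    have "Phi (a \<circ> ?s) k = Phi a k"
      by (rule Phi_cong) simp
    moreover have "Phi a k (r \<circ> ?s) = Phi a k r"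
      by (rule depends_belowD[OF Phi_depends_below]) simp
    ultimately show ?thesis by simp
  qed
  have "top_pair a k r = scale (emb (\<eta> \<alpha> \<beta>) * emb (exp (of_real pi * \<i> * \<N> (a (Suc k)) (a k))))
      (top_pair (a \<circ> ?s) k (r \<circ> ?s))" for r
    unfolding top_pair_def Phi sums
    by (subst loc[OF refl]) (simp add: iota_wz_mult_def iota_zw_mult_def N_sym[OF assms])
  then show ?thesis by blast
qed

text \<open>The mutual factor of the two outermost fields is moved inside the binomial factors of
  field \<open>k\<close>. It is cut off at \<open>q k\<close>, while \<open>top_pair\<close> is not;
  \<open>vanish\<close> makes the terms beyond the cut-off zero.\<close>

lemma Phi_Suc_Suc:
  assumes "a k \<in> B" and vanish: "\<And>q. q k < 0 \<Longrightarrow> Phi a (Suc k) q = 0"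
  shows "Phi a (Suc (Suc k)) = binom_mults (Suc k) (\<lambda>j. \<N> (a (Suc k)) (a j)) k
    (binom_mults k (\<lambda>j. \<N> (a k) (a j)) k (top_pair a k))"
proof -
  define \<nu> where "\<nu> = (\<lambda>j. \<N> (a k) (a j))"
  define N where "N = \<N> (a (Suc k)) (a k)"
  define c where "c = (\<lambda>l. emb ((N gchoose l) * (-1) ^ l))"
  define G where "G = (\<lambda>q. Y (\<iota> (a (Suc k))) (mode a (Suc k) (q (Suc k)))
    (Y (\<iota> (a k)) (mode a k (q k)) (Phi a k q)))"
  define H where "H = (\<lambda>q. Y (\<iota> (a (Suc k))) (mode a (Suc k) (q (Suc k))) (Phi a (Suc k) q))"
  have H: "H = binom_mults k \<nu> k G"
    unfolding H_def G_def \<nu>_def Phi.simps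
    by (rule binom_mults_Y[where g = "mode a (Suc k)", symmetric]) simp_all
  have G_shift: "G (shift (Suc k) k l r) = Y (\<iota> (a (Suc k))) (mode a (Suc k) (r (Suc k) + int l))
      (Y (\<iota> (a k)) (mode a k (r k - int l)) (Phi a k r))" for l r
  proof -
    have "Phi a k (shift (Suc k) k l r) = Phi a k r"
      by (rule depends_belowD[OF Phi_depends_below]) (simp add: shift_def)
    then show ?thesis
      by (simp add: G_def) (simp add: shift_def)
  qed
  have "\<forall>r. \<exists>L0. \<forall>L\<ge>L0. top_pair a k r = (\<Sum>l\<le>L. scale (c l) (G (shift (Suc k) k l r)))"
    unfolding G_shift c_def N_def by (rule allI, rule top_pair_finite_sum) (rule assms(1))
  from choice[OF this] obtain L
    where L: "\<forall>r. \<forall>l\<ge>L r. top_pair a k r = (\<Sum>l\<le>l. scale (c l) (G (shift (Suc k) k l r)))" ..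
  have "binom_mult (Suc k) k N H q = binom_mults k \<nu> k (top_pair a k) q" for q
  proof -
    obtain R where R: "finite R"
      "\<forall>F G. (\<forall>r\<in>R. F r = G r) \<longrightarrow> binom_mults k \<nu> k F q = binom_mults k \<nu> k G q"
      using binom_mults_finite_dependence[of k \<nu> k q] by (elim exE conjE)
    \<comment> \<open>\<open>K\<close> exceeds both the cut-off and the truncation lengths at the
      finitely many indices that matter for \<open>q\<close>.\<close>
    define K where "K = max (nat (q k)) (Max (L ` R))"
    have K: "L r \<le> K" if "r \<in> R" for r
      using R(1) that by (auto simp: K_def intro: max.coboundedI2)
    have agree: "\<forall>r\<in>R. (\<Sum>l\<le>K. scale (c l) (G (shift (Suc k) k l r))) = top_pair a k r"
      using L K by metis
    have "binom_mult (Suc k) k N H q = (\<Sum>l\<le>nat (q k). scale (c l) (H (shift (Suc k) k l q)))"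
      by (simp add: binom_mult_def c_def)
    also have "\<dots> = (\<Sum>l\<le>K. scale (c l) (H (shift (Suc k) k l q)))"
    proof (rule sum.mono_neutral_left)
      have "H (shift (Suc k) k l q) = 0" if "\<not> l \<le> nat (q k)" for l
      proof -
        have "shift (Suc k) k l q k < 0"
          using that by (auto simp: shift_def)
        then show ?thesis
          by (simp only: H_def vanish Y_zero)
      qed
      then show "\<forall>l\<in>{..K} - {..nat (q k)}. scale (c l) (H (shift (Suc k) k l q)) = 0"
        by simp
    qed (auto simp: K_def)
    also have "\<dots> = (\<Sum>l\<le>K. scale (c l) (binom_mults k \<nu> k (\<lambda>r. G (shift (Suc k) k l r)) q))"
      by (simp add: H binom_mults_shift)
    also have "\<dots> = binom_mults k \<nu> k (\<lambda>r. \<Sum>l\<le>K. scale (c l) (G (shift (Suc k) k l r))) q"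
      by (simp add: binom_mults_sum)
    also have "\<dots> = binom_mults k \<nu> k (top_pair a k) q"
      by (rule R(2)[rule_format]) (rule agree[rule_format])
    finally show ?thesis .
  qed
  then have "binom_mult (Suc k) k N H = binom_mults k \<nu> k (top_pair a k)" ..
  then show ?thesis
    by (simp add: H_def[symmetric] N_def \<nu>_def del: Phi.simps(2)) (simp add: H_def N_def \<nu>_def)
qed

text \<open>Once both sides are written by \<open>Phi_Suc_Suc\<close>, they differ by
  \<open>top_pair_swap\<close>, the relabelling of the targets \<open>k\<close> and
  \<open>Suc k\<close>, and the order of commuting factors.\<close>

lemma Phi_swap_top:
  assumes "a k \<in> B" "a (Suc k) \<in> B"
    and "\<And>q. q k < 0 \<Longrightarrow> Phi a (Suc k) q = 0"
    and "\<And>q. q k < 0 \<Longrightarrow> Phi (a \<circ> transpose k (Suc k)) (Suc k) q = 0"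
  shows "\<exists>c. \<forall>q. Phi a (Suc (Suc k)) q =
    scale c (Phi (a \<circ> transpose k (Suc k)) (Suc (Suc k)) (q \<circ> transpose k (Suc k)))"
proof -
  define s where "s = transpose k (Suc k)"
  define \<nu> \<nu>' where "\<nu> = (\<lambda>j. \<N> (a k) (a j))" and "\<nu>' = (\<lambda>j. \<N> (a (Suc k)) (a j))"
  obtain c where c: "\<And>r. top_pair a k r = scale c (top_pair (a \<circ> s) k (r \<circ> s))"
    using top_pair_swap[of a k] assms(1,2) unfolding s_def by blast
  have s: "s k = Suc k" "s (Suc k) = k" "\<And>j. j < k \<Longrightarrow> s j = j"
    by (auto simp: s_def transpose_def)
  have "Phi (a \<circ> s) (Suc (Suc k)) = binom_mults (Suc k) (\<lambda>j. \<N> (a k) ((a \<circ> s) j)) k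
      (binom_mults k (\<lambda>j. \<N> (a (Suc k)) ((a \<circ> s) j)) k (top_pair (a \<circ> s) k))"
    using Phi_Suc_Suc[of "a \<circ> s" k] assms(2,4) by (simp add: s s_def[symmetric] del: Phi.simps)
  also have "\<dots> = binom_mults (Suc k) \<nu> k (binom_mults k \<nu>' k (top_pair (a \<circ> s) k))"
  proof -
    have "binom_mults i (\<lambda>j. \<N> b ((a \<circ> s) j)) k F = binom_mults i (\<lambda>j. \<N> b (a j)) k F" for i b F
      by (rule binom_mults_cong) (simp add: s)
    then show ?thesis
      by (simp add: \<nu>_def \<nu>'_def)
  qed
  finally have swapped: "Phi (a \<circ> s) (Suc (Suc k)) =
      binom_mults (Suc k) \<nu> k (binom_mults k \<nu>' k (top_pair (a \<circ> s) k))" .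
  have conj: "binom_mults i \<mu> k (\<lambda>r. F (r \<circ> s)) = (\<lambda>q. binom_mults (s i) \<mu> k F (q \<circ> s))" for i \<mu> F
    by (rule binom_mults_swap_above) (simp_all add: s_def)
  have "Phi a (Suc (Suc k)) = binom_mults (Suc k) \<nu>' k (binom_mults k \<nu> k
      (\<lambda>r. scale c (top_pair (a \<circ> s) k (r \<circ> s))))"
    unfolding c[symmetric] \<nu>_def \<nu>'_def by (rule Phi_Suc_Suc[OF assms(1,3)])
  also have "\<dots> = (\<lambda>q. scale c (binom_mults k \<nu>' k (binom_mults (Suc k) \<nu> k (top_pair (a \<circ> s) k)) (q \<circ> s)))"
    by (simp only: binom_mults_scale conj s)
  also have "\<dots> = (\<lambda>q. scale c (Phi (a \<circ> s) (Suc (Suc k)) (q \<circ> s)))"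
    unfolding swapped by (subst binom_mults_commute) simp_all
  finally have "\<forall>q. Phi a (Suc (Suc k)) q = scale c (Phi (a \<circ> s) (Suc (Suc k)) (q \<circ> s))"
    by simp
  then show ?thesis
    unfolding s_def by blast
qed

section \<open>Vanishing and symmetry of Phi\<close>

lemma Phi_vanish:
  assumes "\<And>j. j < k \<Longrightarrow> a j \<in> B" "i < k" "q i < 0"
  shows "Phi a k q = 0"
  using assms
proof (induction k arbitrary: a i q)
  case (Suc k)
  \<comment> \<open>A negative exponent of an inner field kills the inner product, and the outer
    factors preserve this.\<close>
  have below: "Phi a (Suc k) q = 0" if "\<And>j. j < k \<Longrightarrow> a j \<in> B" "i < k" "q i < 0" for a i q
    unfolding Phi.simps
    by (rule binom_mults_vanish[of i]) (use Suc.IH that in auto)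
  show ?case
  proof (cases "i < k")
    case True
    with below Suc.prems show ?thesis by simp
  next
    case False
    then have [simp]: "i = k"
      using Suc.prems by simp
    show ?thesis
    proof (cases k)
      case 0
      obtain \<psi> where "(\<lambda>x. zcoeff (Y (\<iota> (a 0))) x vac) = shifted_series \<psi> 0"
        using creation by blast
      then have "Y (\<iota> (a 0)) (of_int (- q 0) - 1) vac = shifted_series \<psi> 0 (of_int (q 0))"
        by (auto simp: zcoeff_def dest: fun_cong[of _ _ "of_int (q 0)"])
      moreover have "(of_int (q 0) :: complex) \<notin> \<nat>"
      proof
        assume "(of_int (q 0) :: complex) \<in> \<nat>"
        then obtain n where "(of_int (q 0) :: complex) = of_int (int n)"
          by (auto elim: Nats_cases)
        then have "q 0 = int n"
          by (simp only: of_int_eq_iff)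
        then show False
          using Suc.prems 0 \<open>i = k\<close> by simp
      qed
      ultimately show ?thesis
        using 0 by (simp add: mode_def shifted_series_def)
    next
      case (Suc l)
      let ?s = "transpose l (Suc l)"
      have B: "a l \<in> B" "a (Suc l) \<in> B" "\<And>j. j < l \<Longrightarrow> a j \<in> B"
        and B': "\<And>j. j < l \<Longrightarrow> (a \<circ> ?s) j \<in> B" "(a \<circ> ?s) l \<in> B"
        using Suc.prems Suc by (auto simp: transpose_def)
      \<comment> \<open>Exchanging the two outermost fields carries the negative exponent to
        position \<open>l\<close>, where \<open>below\<close> applies. The induction hypothesis
        supplies the vanishing that the exchange requires.\<close>
      have "\<exists>c. \<forall>q. Phi a (Suc (Suc l)) q =
          scale c (Phi (a \<circ> ?s) (Suc (Suc l)) (q \<circ> ?s))"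
      proof (rule Phi_swap_top)
        have IH: "Phi b (Suc l) q = 0" if "\<And>j. j < Suc l \<Longrightarrow> b j \<in> B" "q l < 0" for b q
          using Suc.IH[of b l q] Suc that by (simp del: Phi.simps)
        show "Phi a (Suc l) q = 0" if "q l < 0" for q
          using that B by (intro IH) (auto simp: less_Suc_eq)
        show "Phi (a \<circ> ?s) (Suc l) q = 0" if "q l < 0" for q
          using that B' by (intro IH) (auto simp: less_Suc_eq simp del: o_apply)
      qed (use B in auto)
      moreover have "Phi (a \<circ> ?s) (Suc (Suc l)) (q \<circ> ?s) = 0"
        by (rule below[of _ l, unfolded Suc])
          (use B B' Suc Suc.prems in \<open>auto simp: less_Suc_eq simp del: o_apply\<close>, simp)
      ultimately show ?thesis
        using Suc by auto
    qed
  qed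
qed simp

text \<open>When the pair is outermost, the swap fixes the sequence \<open>a\<close> and
  \<open>Phi_swap_top\<close> applies. Each further field has equal exponents with both members of
  the pair, so \<open>binom_mults_swap_inside\<close> carries the relation along.\<close>

lemma Phi_swap:
  assumes "\<And>j. j < k \<Longrightarrow> a j \<in> B" "Suc p < k" "a p = a (Suc p)"
  shows "\<exists>c. \<forall>q. Phi a k q = scale c (Phi a k (q \<circ> transpose p (Suc p)))"
  using assms(1,2)
proof (induction k)
  case (Suc k)
  let ?s = "transpose p (Suc p)"
  show ?case
  proof (cases "k = Suc p")
    case True
    have a: "a \<circ> ?s = a"
      using assms(3) by (auto simp: transpose_def)
    have vanish: "Phi a (Suc p) q = 0" if "q p < 0" for q
      using Suc.prems True that by (intro Phi_vanish[of _ _ p]) auto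
    show ?thesis
      unfolding True
    proof (rule Phi_swap_top[of a p, unfolded a])
      show "a p \<in> B" "a (Suc p) \<in> B"
        by (rule Suc.prems(1), simp add: True)+
    qed (fact vanish)+
  next
    case False
    then have "\<exists>c. \<forall>q. Phi a k q = scale c (Phi a k (q \<circ> ?s))"
      using Suc.prems(2) by (intro Suc.IH Suc.prems(1)) simp_all
    then obtain c where c: "\<And>q. Phi a k q = scale c (Phi a k (q \<circ> ?s))"
      by blast
    let ?\<nu> = "\<lambda>j. \<N> (a k) (a j)"
    let ?F = "\<lambda>q. Y (\<iota> (a k)) (mode a k (q k)) (Phi a k q)"
    have sk: "?s k = k"
      using False Suc.prems by (simp add: transpose_def)
    have "?F q = scale c (?F (q \<circ> ?s))" for q
      by (subst c) (simp add: Y_scale sk)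
    then have "?F = (\<lambda>q. scale c (?F (q \<circ> ?s)))"
      by (rule ext)
    then have "binom_mults k ?\<nu> k ?F = binom_mults k ?\<nu> k (\<lambda>q. scale c (?F (q \<circ> ?s)))"
      by (rule arg_cong)
    also have "\<dots> = (\<lambda>q. scale c (binom_mults k ?\<nu> k ?F (q \<circ> ?s)))"
      unfolding binom_mults_scale
      by (subst binom_mults_swap_inside[of p]) (use False Suc.prems assms(3) in auto)
    finally have "Phi a (Suc k) = (\<lambda>q. scale c (Phi a (Suc k) (q \<circ> ?s)))"
      by simp
    then show ?thesis
      by metis
  qed
qed simp

section \<open>Triangularity of Phi over Psi\<close>

definition lower_span :: "(nat \<Rightarrow> 'b) \<Rightarrow> nat \<Rightarrow> (nat \<Rightarrow> int) \<Rightarrow> 'v set" where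
  "lower_span a k q = span {Psi_coeff a k r | r.
     (\<Sum>x<k. r x) = (\<Sum>x<k. q x) \<and> partial_sums_total k r < partial_sums_total k q}"

lemma lower_span_base:
  "(\<Sum>x<k. r x) = (\<Sum>x<k. q x) \<Longrightarrow> partial_sums_total k r < partial_sums_total k q \<Longrightarrow>
    Psi_coeff a k r \<in> lower_span a k q"
  unfolding lower_span_def by (rule span_base) blast

lemma lower_span_mono:
  "(\<Sum>x<k. r x) = (\<Sum>x<k. q x) \<Longrightarrow> partial_sums_total k r \<le> partial_sums_total k q \<Longrightarrow>
    lower_span a k r \<subseteq> lower_span a k q"
  unfolding lower_span_def by (rule span_mono) auto

lemma lower_span_subset:
  assumes "subspace S"
    and "\<And>r. (\<Sum>x<k. r x) = (\<Sum>x<k. q x) \<Longrightarrow> partial_sums_total k r < partial_sums_total k q \<Longrightarrow>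
      Psi_coeff a k r \<in> S"
  shows "lower_span a k q \<subseteq> S"
  unfolding lower_span_def by (rule span_minimal) (use assms in auto)

lemma subspace_lower_span: "subspace (lower_span a k q)"
  unfolding lower_span_def by (rule subspace_span)

text \<open>In each factor the term without shift reproduces \<open>F q\<close>. All others move
  weight from \<open>n\<close> to the later position \<open>i\<close>, hence lie in the lower
  span.\<close>

lemma binom_mults_lower:
  assumes "\<And>q. F q - Psi_coeff a k q \<in> lower_span a k q" "n \<le> i" "i < k"
  shows "binom_mults i \<nu> n F q - Psi_coeff a k q \<in> lower_span a k q"
  using assms(1,2)
proof (induction n arbitrary: F)
  case (Suc n)
  have "binom_mult i n (\<nu> n) F q - Psi_coeff a k q \<in> lower_span a k q" for q
  proof -
    let ?t = "\<lambda>m. scale (emb ((\<nu> n gchoose m) * (-1) ^ m)) (F (shift i n m q))"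
    have F: "F (shift i n m q) \<in> lower_span a k q" if "m \<ge> 1" for m
    proof -
      have less: "(\<Sum>x<k. shift i n m q x) = (\<Sum>x<k. q x)"
        "partial_sums_total k (shift i n m q) < partial_sums_total k q"
        using that Suc.prems assms(3) by (auto intro: sum_shift partial_sums_total_shift)
      have "F (shift i n m q) - Psi_coeff a k (shift i n m q) \<in> lower_span a k q"
        using Suc.prems(1) lower_span_mono[OF less(1) less_imp_le[OF less(2)]] by blast
      from subspace_add[OF subspace_lower_span this lower_span_base[OF less]] show ?thesis
        by simp
    qed
    have "(\<Sum>m\<le>nat (q n). ?t m) = ?t 0 + (\<Sum>m\<in>{..nat (q n)} - {0}. ?t m)"
      by (rule sum.remove) auto
    then have "binom_mult i n (\<nu> n) F q = F q + (\<Sum>m\<in>{..nat (q n)} - {0}. ?t m)"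
      by (simp add: binom_mult_def emb_one)
    moreover have "(\<Sum>m\<in>{..nat (q n)} - {0}. ?t m) \<in> lower_span a k q"
      by (intro subspace_sum subspace_scale subspace_lower_span F) auto
    ultimately show ?thesis
      using subspace_add[OF subspace_lower_span Suc.prems(1)[of q]] by (simp add: add_diff_eq[symmetric] diff_add_eq)
  qed
  with Suc show ?case by simp
qed simp

lemma Phi_minus_Psi_coeff: "Phi a k q - Psi_coeff a k q \<in> lower_span a k q"
proof (induction k arbitrary: q)
  case 0
  show ?case by (simp add: subspace_0 subspace_lower_span)
next
  case (Suc k)
  have "Y (\<iota> (a k)) (mode a k (q k)) (Phi a k q) - Psi_coeff a (Suc k) q \<in> lower_span a (Suc k) q" for q
  proof -
    let ?Y = "Y (\<iota> (a k)) (mode a k (q k))"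
    have "?Y (Phi a k q - Psi_coeff a k q) \<in> span (?Y ` {Psi_coeff a k r | r.
        (\<Sum>x<k. r x) = (\<Sum>x<k. q x) \<and> partial_sums_total k r < partial_sums_total k q})"
      using Suc[of q] unfolding lower_span_def by (rule Y_span)
    also have "\<dots> \<subseteq> lower_span a (Suc k) q"
    proof (rule span_minimal[OF _ subspace_lower_span], clarify)
      fix r
      assume r: "(\<Sum>x<k. r x) = (\<Sum>x<k. q x)" "partial_sums_total k r < partial_sums_total k q"
      \<comment> \<open>Entry \<open>k\<close> of \<open>r\<close> is free; this choice makes the
        mode of the outer field fit. The new partial sum is the old total, the same for
        \<open>r\<close> and \<open>q\<close>, so the measure still drops.\<close>
      let ?r = "r(k := q k)"
      have "Psi_coeff a k ?r = Psi_coeff a k r"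
        by (rule depends_belowD[OF Psi_coeff_depends_below]) simp
      then have "?Y (Psi_coeff a k r) = Psi_coeff a (Suc k) ?r"
        by simp
      also have "\<dots> \<in> lower_span a (Suc k) q"
      proof (rule lower_span_base)
        show "(\<Sum>x<Suc k. ?r x) = (\<Sum>x<Suc k. q x)"
          using r(1) by simp
        have "partial_sums_total k ?r = partial_sums_total k r"
          by (rule partial_sums_total_cong) simp
        then show "partial_sums_total (Suc k) ?r < partial_sums_total (Suc k) q"
          using r by (simp add: partial_sums_total_Suc)
      qed
      finally show "?Y (Psi_coeff a k r) \<in> lower_span a (Suc k) q" .
    qed
    finally show ?thesis
      by (simp add: Y_diff)
  qed
  then show ?case
    unfolding Phi.simps by (rule binom_mults_lower) auto
qed

lemma Psi_coeff_zero_above: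
  "Psi_coeff a l q = 0 \<Longrightarrow> l \<le> k \<Longrightarrow> Psi_coeff a k q = 0"
  by (induction k) (auto simp: le_Suc_eq simp del: Psi_coeff_0)

section \<open>Induction on the measure: vanishing and spanning\<close>

text \<open>Here \<open>neg\<close> gives the integer measure a floor. In \<open>step\<close> either
  vector suffices, because by induction the two are congruent modulo \<open>S\<close>.\<close>

lemma Psi_coeff_in_subspaceI:
  assumes S: "subspace S"
    and neg: "\<And>r. partial_sums_total k r < 0 \<Longrightarrow> Psi_coeff a k r = 0"
    and step: "\<And>r. (\<Sum>x<k. r x) = M \<Longrightarrow>
      (\<And>r'. (\<Sum>x<k. r' x) = M \<Longrightarrow> partial_sums_total k r' < partial_sums_total k r \<Longrightarrow> Psi_coeff a k r' \<in> S) \<Longrightarrow>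
      Phi a k r \<in> S \<or> Psi_coeff a k r \<in> S"
    and "(\<Sum>x<k. q x) = M"
  shows "Psi_coeff a k q \<in> S"
  using assms(4)
\<comment> \<open>The \<open>+ 1\<close> separates measure 0 from negative measures, which
  \<open>nat\<close> would otherwise identify.\<close>
proof (induction "nat (partial_sums_total k q + 1)" arbitrary: q rule: less_induct)
  case less
  show ?case
  proof (cases "partial_sums_total k q < 0")
    case True
    then show ?thesis
      using neg S subspace_0 by simp
  next
    case False
    then have IH: "Psi_coeff a k r \<in> S"
      if "(\<Sum>x<k. r x) = M" "partial_sums_total k r < partial_sums_total k q" for r
      using that by (intro less.hyps) auto
    then have "lower_span a k q \<subseteq> S"
      using less.prems by (intro lower_span_subset S) auto
    then have *: "Phi a k q - Psi_coeff a k q \<in> S"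
      using Phi_minus_Psi_coeff by blast
    from step[OF less.prems IH] show ?thesis
    proof
      assume "Phi a k q \<in> S"
      from subspace_diff[OF S this *] show ?thesis by simp
    qed
  qed
qed

text \<open>Take \<open>S = {0}\<close>. A negative measure means a negative proper partial sum, so
  a shorter product already vanishes; a negative total means a negative entry, so \<open>Phi\<close>
  vanishes.\<close>

lemma Psi_coeff_vanish:
  assumes "\<And>j. j < k \<Longrightarrow> a j \<in> B" "(\<Sum>x<k. q x) < 0"
  shows "Psi_coeff a k q = 0"
  using assms
proof (induction k arbitrary: q rule: less_induct)
  case (less k)
  have "Psi_coeff a k q \<in> {0}"
  proof (rule Psi_coeff_in_subspaceI)
    fix r
    assume "partial_sums_total k r < 0"
    then obtain l where "l < k" "(\<Sum>x<l. r x) < 0"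
      unfolding partial_sums_total_def by (metis lessThan_iff not_less sum_nonneg)
    then show "Psi_coeff a k r = 0"
      using less by (intro Psi_coeff_zero_above[of a l r k]) auto
  next
    fix r
    assume "(\<Sum>x<k. r x) = (\<Sum>x<k. q x)"
    then obtain j where "j < k" "r j < 0"
      using less.prems(2) by (metis lessThan_iff not_less sum_nonneg)
    then show "Phi a k r \<in> {0} \<or> Psi_coeff a k r \<in> {0}"
      using Phi_vanish less.prems(1) by blast
  qed (use less.prems in auto)
  then show ?case by simp
qed

lemma Psi_coeff_eq_0_if_partial_sums_total_neg:
  assumes "\<And>j. j < k \<Longrightarrow> a j \<in> B" "partial_sums_total k q < 0"
  shows "Psi_coeff a k q = 0"
proof -
  obtain l where "l < k" "(\<Sum>x<l. q x) < 0"
    using assms(2) unfolding partial_sums_total_def by (metis lessThan_iff not_less sum_nonneg)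
  then show ?thesis
    using assms(1) by (intro Psi_coeff_zero_above[OF Psi_coeff_vanish]) auto
qed

text \<open>With a negative entry \<open>Phi\<close> is zero; a sorted tuple is a generator.
  Otherwise swapping a descent of equal neighbours lowers the measure, so \<open>Phi\<close> at the
  swapped tuple is in the span, and \<open>Phi_swap\<close> brings this back.\<close>

lemma Psi_coeff_in_span_sorted:
  assumes "\<And>j. j < k \<Longrightarrow> a j \<in> B"
    and contiguous: "\<And>i j l. i \<le> j \<Longrightarrow> j \<le> l \<Longrightarrow> l < k \<Longrightarrow> a i = a l \<Longrightarrow> a j = a l"
    and "(\<Sum>x<k. q x) = M"
  shows "Psi_coeff a k q \<in> span {Psi_coeff a k r | r. (\<Sum>x<k. r x) = M \<and> (\<forall>j<k. 0 \<le> r j) \<and>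
    (\<forall>i j. i < j \<and> j < k \<and> a i = a j \<longrightarrow> r i \<le> r j)}" (is "_ \<in> span ?C")
proof (rule Psi_coeff_in_subspaceI[OF subspace_span])
  fix r
  assume r: "(\<Sum>x<k. r x) = M"
    and IH: "\<And>r'. (\<Sum>x<k. r' x) = M \<Longrightarrow> partial_sums_total k r' < partial_sums_total k r \<Longrightarrow>
      Psi_coeff a k r' \<in> span ?C"
  show "Phi a k r \<in> span ?C \<or> Psi_coeff a k r \<in> span ?C"
  proof (cases "\<exists>j<k. r j < 0")
    case True
    then have "Phi a k r = 0"
      using Phi_vanish assms(1) by blast
    then show ?thesis
      by (simp add: span_zero)
  next
    case nonneg: False
    show ?thesis
    proof (cases "\<forall>p. Suc p < k \<and> a p = a (Suc p) \<longrightarrow> r p \<le> r (Suc p)")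
      case True
      \<comment> \<open>Equal fields occupy adjacent positions by \<open>contiguous\<close>, so
        comparing neighbours suffices.\<close>
      have "r i \<le> r j" if "i \<le> j" "j < k" "a i = a j" for i j
        using that
      proof (induction j rule: dec_induct)
        case (step j)
        have "a j = a (Suc j)"
          using contiguous[of i j "Suc j"] step by simp
        then show ?case
          using step True by force
      qed simp
      then have "Psi_coeff a k r \<in> ?C"
        using nonneg r by (intro CollectI exI[of _ r]) (simp, meson not_less)
      then show ?thesis
        by (simp add: span_base)
    next
      case False
      then obtain p where p: "Suc p < k" "a p = a (Suc p)" "r (Suc p) < r p"
        by (auto simp: not_le)
      let ?r = "r \<circ> transpose p (Suc p)"
      have "?r = shift (Suc p) p (nat (r p - r (Suc p))) r"
        using p by (intro swap_eq_shift) auto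
      then have r': "(\<Sum>x<k. ?r x) = M" "partial_sums_total k ?r < partial_sums_total k r"
        using p r by (simp_all add: sum_shift partial_sums_total_shift del: o_apply)
      have "lower_span a k ?r \<subseteq> span ?C"
        using r' by (intro lower_span_subset subspace_span IH) auto
      then have "Phi a k ?r - Psi_coeff a k ?r \<in> span ?C"
        using Phi_minus_Psi_coeff by blast
      from span_add[OF this IH[OF r']] have "Phi a k ?r \<in> span ?C"
        by simp
      moreover obtain c where "Phi a k r = scale c (Phi a k ?r)"
        using Phi_swap[OF assms(1) p(1,2)] by blast
      ultimately show ?thesis
        by (simp add: span_scale)
    qed
  qed
qed (use assms Psi_coeff_eq_0_if_partial_sums_total_neg in auto)

section \<open>Return to the original indices\<close>

lemma Psi_eq_Psi_coeff: "Psi Y vac \<iota> \<N> a (\<lambda>j. of_int (m j)) k = Psi_coeff a k (\<lambda>j. - m j - 1)"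
  by (simp add: Psi_coeff_def)

text \<open>The substitution \<open>q = - m - 1\<close> is an involution and turns total
  \<open>M\<close> into \<open>- M - int k\<close>, which is negative exactly when
  \<open>M > - int k\<close>.\<close>

lemma V_span_eq:
  "V_span scale Y vac \<iota> \<N> a k M = span {Psi_coeff a k q | q. (\<Sum>x<k. q x) = - M - int k}"
proof -
  have "{Psi Y vac \<iota> \<N> a (\<lambda>j. of_int (m j)) k | m. (\<Sum>j<k. m j) = M} =
      {Psi_coeff a k q | q. (\<Sum>x<k. q x) = - M - int k}" (is "?L = ?R")
  proof (intro set_eqI iffI)
    fix v assume "v \<in> ?L"
    then obtain m where m: "v = Psi_coeff a k (\<lambda>j. - m j - 1)" "(\<Sum>j<k. m j) = M"
      by (auto simp: Psi_eq_Psi_coeff)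
    then show "v \<in> ?R"
      by (auto simp: sum_subtractf sum_negf intro!: exI[of _ "\<lambda>j. - m j - 1"])
  next
    fix v assume "v \<in> ?R"
    then obtain q where "v = Psi_coeff a k q" "(\<Sum>x<k. q x) = - M - int k"
      by blast
    then show "v \<in> ?L"
      by (auto simp: Psi_coeff_def sum_subtractf sum_negf intro!: exI[of _ "\<lambda>j. - q j - 1"])
  qed
  then show ?thesis
    by (simp add: V_span_def)
qed

text \<open>Under \<open>m = - r - 1\<close>, non-negative entries become negative and increasing
  order on equal fields becomes decreasing.\<close>

lemma C_set_supset:
  "{Psi_coeff a k r | r. (\<Sum>x<k. r x) = - M - int k \<and> (\<forall>j<k. 0 \<le> r j) \<and>
    (\<forall>i j. i < j \<and> j < k \<and> a i = a j \<longrightarrow> r i \<le> r j)} \<subseteq> C_set Y vac \<iota> \<N> a k M"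
proof clarify
  fix r
  assume "(\<Sum>x<k. r x) = - M - int k" "\<forall>j<k. 0 \<le> r j"
    "\<forall>i j. i < j \<and> j < k \<and> a i = a j \<longrightarrow> r i \<le> r j"
  then show "Psi_coeff a k r \<in> C_set Y vac \<iota> \<N> a k M"
    unfolding C_set_def Psi_coeff_def
    by (intro CollectI exI[of _ "\<lambda>j. - r j - 1"] conjI allI impI diff_right_mono le_imp_neg_le)
      (auto simp: sum_subtractf sum_negf intro: less_le_trans[of _ 0])
qed

lemma span_C_set:
  assumes "\<And>j. j < k \<Longrightarrow> a j \<in> B"
    and "\<And>i j l. i \<le> j \<Longrightarrow> j \<le> l \<Longrightarrow> l < k \<Longrightarrow> a i = a l \<Longrightarrow> a j = a l"
  shows "span (C_set Y vac \<iota> \<N> a k M) = V_span scale Y vac \<iota> \<N> a k M"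
proof
  show "span (C_set Y vac \<iota> \<N> a k M) \<subseteq> V_span scale Y vac \<iota> \<N> a k M"
    unfolding V_span_def C_set_def by (rule span_mono) blast
  show "V_span scale Y vac \<iota> \<N> a k M \<subseteq> span (C_set Y vac \<iota> \<N> a k M)"
    unfolding V_span_eq
  proof (rule span_minimal[OF _ subspace_span], clarify)
    fix q assume "(\<Sum>x<k. q x) = - M - int k"
    show "Psi_coeff a k q \<in> span (C_set Y vac \<iota> \<N> a k M)"
      by (rule subsetD[OF span_mono[OF C_set_supset] Psi_coeff_in_span_sorted]) (fact | rule assms)+
  qed
qed

lemma V_span_zero:
  assumes "\<And>j. j < k \<Longrightarrow> a j \<in> B" "M > - int k"
  shows "V_span scale Y vac \<iota> \<N> a k M = {0}"
proof -
  have "{Psi_coeff a k q | q. (\<Sum>x<k. q x) = - M - int k} \<subseteq> {0}"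
    using assms Psi_coeff_vanish by auto
  then show ?thesis
    unfolding V_span_eq using span_minimal[OF _ subspace_single_0] span_zero by blast
qed

end

theorem theorem3p2:
  fixes scale :: "'k :: field \<Rightarrow> 'v :: ab_group_add \<Rightarrow> 'v"
    and emb :: "complex \<Rightarrow> 'k"
    and Y :: "'v \<Rightarrow> complex \<Rightarrow> 'v \<Rightarrow> 'v"
    and vac :: 'v
    and T :: "'v \<Rightarrow> 'v"
    and Vgr :: "'q :: ab_group_add \<Rightarrow> 'v set"
    and \<Delta> :: "'q \<Rightarrow> 'q \<Rightarrow> complex_mod_int"
    and \<eta> :: "'q \<Rightarrow> 'q \<Rightarrow> complex"
    and B :: "'b :: linorder set"
    and \<iota> :: "'b \<Rightarrow> 'v"
    and \<N> :: "'b \<Rightarrow> 'b \<Rightarrow> complex"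
    and a :: "nat \<Rightarrow> 'b"
    and k :: nat
    and M :: int
  assumes gva: "gva_charge_factor scale emb Y vac T Vgr \<Delta> \<eta>"
    and homogeneous: "\<And>b. b \<in> B \<Longrightarrow> \<iota> b \<noteq> 0 \<and> (\<exists>\<alpha>. \<iota> b \<in> Vgr \<alpha>)"
    and generates: "generated_subspace scale Y vac T (\<iota> ` B) = UNIV"
    and N_sym: "\<And>b c. b \<in> B \<Longrightarrow> c \<in> B \<Longrightarrow> \<N> b c = \<N> c b"
    and N_bound: "\<And>b c \<alpha> \<beta>. b \<in> B \<Longrightarrow> c \<in> B \<Longrightarrow> \<iota> b \<in> Vgr \<alpha> \<Longrightarrow> \<iota> c \<in> Vgr \<beta> \<Longrightarrow>
      is_locality_bound emb scale \<Delta> \<alpha> \<beta> (\<eta> \<alpha> \<beta>) (Y (\<iota> b)) (Y (\<iota> c)) (\<N> b c)"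
    and a_in_B: "\<And>j. j < k \<Longrightarrow> a j \<in> B"
    and a_increasing: "\<And>i j. i \<le> j \<Longrightarrow> j < k \<Longrightarrow> a i \<le> a j"
  shows "module.span scale (C_set Y vac \<iota> \<N> a k M) = V_span scale Y vac \<iota> \<N> a k M \<and>
    (M > - int k \<longrightarrow> V_span scale Y vac \<iota> \<N> a k M = {0})"
proof -
  interpret gva_charge_factor scale emb Y vac T Vgr \<Delta> \<eta>
    by (rule gva)
  interpret gva_generators scale emb Y vac T Vgr \<Delta> \<eta> B \<iota> \<N>
    by unfold_locales (use homogeneous N_sym N_bound in blast)+
  \<comment> \<open>Monotonicity squeezes \<open>a j\<close> between the equal ends
    \<open>a i\<close> and \<open>a l\<close>.\<close>
  have "a j = a l" if "i \<le> j" "j \<le> l" "l < k" "a i = a l" for i j l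
    using a_increasing[of i j] a_increasing[of j l] that by simp
  with span_C_set[of k a M] a_in_B
  have "span (C_set Y vac \<iota> \<N> a k M) = V_span scale Y vac \<iota> \<N> a k M"
    by metis
  with V_span_zero[of k a M] a_in_B show ?thesis
    by simp
qed

end
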